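(* Let $I\subset\mathbb R\setminus\{0\}$ be an open interval, $f:I\to\mathbb R$ smooth with $f'^2<1$ and $f''\neq0$ everywhere on $I$, and let $C_4\neq0$ be a real constant. Let $M$ be the rotational hypersurface $\Gamma^s(s,t,w)=(s\cosh t\cosh w,\ s\sinh t,\ s\cosh t\sinh w,\ f(s))$ in $\mathbb E_1^4$ with Gauss map $N^{s}=-\frac{1}{\sqrt{1-f'^2}}(f'\cosh t\cosh w,\ f'\sinh t,\ f'\cosh t\sinh w,\ 1)$, and assume $L_2N^s$ is not identically zero. If the differential equation $$\left(C_4\sqrt{1-f'^2}-1\right)\Big(s(f'^2-1)f'f'''+2f''\big(f'(f'^2-1)^2-s(2f'^2+1)f''\big)\Big)+sf'^2\Big((f'^2-1)f'f'''-3(f'^2+1)f''^2\Big)=0$$ holds on $I$, then $M$ has second kind $L_2$-pointwise 1-type Gauss map; namely $L_2N^s=\mathfrak m(N^s+C)$ for some non-zero smooth function $\mathfrak m$, with $C=(0,0,0,C_4)$.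
   Context: $\mathbb E_1^4$ is $\mathbb R^4$ with the Lorentzian metric $\langle\,,\rangle=-dx_1^2+dx_2^2+dx_3^2+dx_4^2$. Let $M$ be an oriented hypersurface of $\mathbb E_1^4$ with nondegenerate induced metric $g$, unit normal vector field (Gauss map) $N$, $\varepsilon=\langle N,N\rangle=\pm1$, shape operator $S=-dN$ and principal curvatures $\kappa_1,\kappa_2,\kappa_3$. Put $a_0=1$, $a_1=-(\kappa_1+\kappa_2+\kappa_3)$, $a_2=\kappa_1\kappa_2+\kappa_1\kappa_3+\kappa_2\kappa_3$, $a_3=-\kappa_1\kappa_2\kappa_3$. The Newton transformations are $P_0=I$, $P_k=a_kI+S\circ P_{k-1}$, and $L_k(\varphi)=\mathrm{tr}(P_k\circ\nabla^2\varphi)$ for $\varphi\in C^\infty(M)$, where $\nabla^2\varphi$ is the Hessian operator of $\varphi$ with respect to $g$; $L_k$ acts componentwise on $\mathbb R^4$-valued functions such as $N$. With $n=3$, $\binom{n}{k}H_k=(-\varepsilon)^ka_k$ and $C_k=\binom{n}{k+1}(-\varepsilon)^k$, the known formula used for the Gauss map is $L_kN=-\varepsilon C_k\big(\nabla H_{k+1}+(nH_1H_{k+1}-(n-k-1)H_{k+2})N\big)$, where $\nabla$ is the gradient of $g$ (for $k=2$ the last term has coefficient $0$). $M$ has second kind $L_k$-pointwise 1-type Gauss map if $L_kN=\mathfrak m(N+C)$ for a non-zero (i.e. not identically zero) smooth function $\mathfrak m$ on $M$ and a non-zero constant vector $C\in\mathbb E_1^4$. Primes denote $d/ds$; $s\in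 I$ and $t,w\in\mathbb R$. *)

theory Defs
  imports "HOL-Analysis.Analysis"
begin

(* For open U this is the usual notion of a map of class C^k: all iterated partial
   derivatives up to order k exist and are continuous on U. *)
primrec Ck_on :: "nat \<Rightarrow> 'a::euclidean_space set \<Rightarrow> ('a \<Rightarrow> 'b::real_normed_vector) \<Rightarrow> bool" where
  "Ck_on 0 U h \<longleftrightarrow> continuous_on U h"
| "Ck_on (Suc k) U h \<longleftrightarrow>
     (\<forall>x\<in>U. h differentiable (at x)) \<and>
     (\<forall>b\<in>Basis. Ck_on k U (\<lambda>x. frechet_derivative h (at x) b))"

definition smooth_on :: "'a::euclidean_space set \<Rightarrow> ('a \<Rightarrow> 'b::real_normed_vector) \<Rightarrow> bool" where
  "smooth_on U h \<longleftrightarrow> (\<forall>k. Ck_on k U h)"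

definition pderiv_at :: "3 \<Rightarrow> (real^3 \<Rightarrow> 'b::real_normed_vector) \<Rightarrow> real^3 \<Rightarrow> 'b" where
  "pderiv_at i h p = frechet_derivative h (at p) (axis i 1)"

definition lorentz :: "real^4 \<Rightarrow> real^4 \<Rightarrow> real" where
  "lorentz x y = - (x $ 1 * y $ 1) + x $ 2 * y $ 2 + x $ 3 * y $ 3 + x $ 4 * y $ 4"

(* A hypersurface M is given by a parametrization X on an open set U of R^3.  Functions on M,
   in particular the Gauss map N, are functions of the parameter; tangent vectors and (1,1)
   tensors are given by their components in the coordinate frame X_1, X_2, X_3, where the
   entry A $ i $ j of a (1,1) tensor is the X_i-component of the image of X_j. *)

definition metric :: "(real^3 \<Rightarrow> real^4) \<Rightarrow> real^3 \<Rightarrow> real^3^3" where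
  "metric X p = (\<chi> i j. lorentz (pderiv_at i X p) (pderiv_at j X p))"

definition oriented_hypersurface ::
    "(real^3) set \<Rightarrow> (real^3 \<Rightarrow> real^4) \<Rightarrow> (real^3 \<Rightarrow> real^4) \<Rightarrow> bool" where
  "oriented_hypersurface U X N \<longleftrightarrow>
     open U \<and> smooth_on U X \<and> smooth_on U N \<and>
     (\<forall>p\<in>U. det (metric X p) \<noteq> 0) \<and>
     (\<forall>p\<in>U. \<forall>i. lorentz (N p) (pderiv_at i X p) = 0) \<and>
     (\<exists>\<epsilon>\<in>{-1, 1}. \<forall>p\<in>U. lorentz (N p) (N p) = \<epsilon>)"

definition christoffel ::
    "(real^3 \<Rightarrow> real^4) \<Rightarrow> 3 \<Rightarrow> 3 \<Rightarrow> 3 \<Rightarrow> real^3 \<Rightarrow> real" where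
  "christoffel X k i j p =
     (1 / 2) * (\<Sum>l\<in>UNIV. matrix_inv (metric X p) $ k $ l *
       (pderiv_at i (\<lambda>q. metric X q $ j $ l) p
        + pderiv_at j (\<lambda>q. metric X q $ i $ l) p
        - pderiv_at l (\<lambda>q. metric X q $ i $ j) p))"

definition gradient ::
    "(real^3 \<Rightarrow> real^4) \<Rightarrow> (real^3 \<Rightarrow> real) \<Rightarrow> real^3 \<Rightarrow> real^3" where
  "gradient X \<phi> p =
     (\<chi> i. \<Sum>j\<in>UNIV. matrix_inv (metric X p) $ i $ j * pderiv_at j \<phi> p)"

(* The Hessian operator sends a tangent vector Y to the covariant derivative of the gradient
   in the direction Y (Levi-Civita connection of the induced metric). *)
definition hessian_op ::
    "(real^3 \<Rightarrow> real^4) \<Rightarrow> (real^3 \<Rightarrow> real) \<Rightarrow> real^3 \<Rightarrow> real^3^3" where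
  "hessian_op X \<phi> p =
     (\<chi> i j. pderiv_at j (\<lambda>q. gradient X \<phi> q $ i) p
        + (\<Sum>k\<in>UNIV. christoffel X i j k p * gradient X \<phi> p $ k))"

(* S = -dN. *)
definition shape_op ::
    "(real^3 \<Rightarrow> real^4) \<Rightarrow> (real^3 \<Rightarrow> real^4) \<Rightarrow> real^3 \<Rightarrow> real^3^3" where
  "shape_op X N p =
     (THE A. \<forall>j. - pderiv_at j N p = (\<Sum>i\<in>UNIV. A $ i $ j *\<^sub>R pderiv_at i X p))"

(* The eigenvalues of the shape operator, listed with algebraic multiplicity.  The choice of
   the order is immaterial, as only symmetric functions of them are used.  The value is
   meaningful when all eigenvalues are real, which is not automatic in the Lorentzian case. *)
definition principal_curvatures ::
    "(real^3 \<Rightarrow> real^4) \<Rightarrow> (real^3 \<Rightarrow> real^4) \<Rightarrow> real^3 \<Rightarrow> real^3" where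
  "principal_curvatures X N p =
     (SOME \<kappa>. \<forall>z. det (mat z - shape_op X N p) = (z - \<kappa> $ 1) * (z - \<kappa> $ 2) * (z - \<kappa> $ 3))"

definition curv_coeff ::
    "(real^3 \<Rightarrow> real^4) \<Rightarrow> (real^3 \<Rightarrow> real^4) \<Rightarrow> nat \<Rightarrow> real^3 \<Rightarrow> real" where
  "curv_coeff X N k p =
     (let \<kappa> = principal_curvatures X N p in
      if k = 0 then 1
      else if k = 1 then - (\<kappa> $ 1 + \<kappa> $ 2 + \<kappa> $ 3)
      else if k = 2 then \<kappa> $ 1 * \<kappa> $ 2 + \<kappa> $ 1 * \<kappa> $ 3 + \<kappa> $ 2 * \<kappa> $ 3
      else if k = 3 then - (\<kappa> $ 1 * \<kappa> $ 2 * \<kappa> $ 3)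
      else 0)"

primrec newton ::
    "(real^3 \<Rightarrow> real^4) \<Rightarrow> (real^3 \<Rightarrow> real^4) \<Rightarrow> nat \<Rightarrow> real^3 \<Rightarrow> real^3^3" where
  "newton X N 0 p = mat 1"
| "newton X N (Suc k) p = mat (curv_coeff X N (Suc k) p) + shape_op X N p ** newton X N k p"

definition L_op ::
    "nat \<Rightarrow> (real^3 \<Rightarrow> real^4) \<Rightarrow> (real^3 \<Rightarrow> real^4) \<Rightarrow> (real^3 \<Rightarrow> real) \<Rightarrow> real^3 \<Rightarrow> real" where
  "L_op k X N \<phi> p = trace (newton X N k p ** hessian_op X \<phi> p)"

definition L_vec ::
    "nat \<Rightarrow> (real^3 \<Rightarrow> real^4) \<Rightarrow> (real^3 \<Rightarrow> real^4) \<Rightarrow> (real^3 \<Rightarrow> real^4) \<Rightarrow> real^3 \<Rightarrow> real^4" where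
  "L_vec k X N F p = (\<chi> i. L_op k X N (\<lambda>q. F q $ i) p)"

definition second_kind_pointwise_1_type_gauss ::
    "nat \<Rightarrow> (real^3) set \<Rightarrow> (real^3 \<Rightarrow> real^4) \<Rightarrow> (real^3 \<Rightarrow> real^4) \<Rightarrow> bool" where
  "second_kind_pointwise_1_type_gauss k U X N \<longleftrightarrow>
     oriented_hypersurface U X N \<and>
     (\<exists>m C. smooth_on U m \<and> (\<exists>p\<in>U. m p \<noteq> 0) \<and> C \<noteq> 0 \<and>
            (\<forall>p\<in>U. L_vec k X N N p = m p *\<^sub>R (N p + C)))"

(* The parameters are (s, t, w) = (p $ 1, p $ 2, p $ 3). *)

definition rot_domain :: "real set \<Rightarrow> (real^3) set" where
  "rot_domain I = {p. p $ 1 \<in> I}"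

definition rot_hypersurface :: "(real \<Rightarrow> real) \<Rightarrow> real^3 \<Rightarrow> real^4" where
  "rot_hypersurface f p =
     (let s = p $ 1; t = p $ 2; w = p $ 3 in
      vector [s * cosh t * cosh w, s * sinh t, s * cosh t * sinh w, f s])"

definition rot_gauss :: "(real \<Rightarrow> real) \<Rightarrow> real^3 \<Rightarrow> real^4" where
  "rot_gauss f p =
     (let s = p $ 1; t = p $ 2; w = p $ 3; f' = deriv f s in
      (- (1 / sqrt (1 - f'^2))) *\<^sub>R
        vector [f' * cosh t * cosh w, f' * sinh t, f' * cosh t * sinh w, 1])"

end

theory Submission
  imports Defs
begin

text \<open>
  Put \<open>W = sqrt (1 - f'\<^sup>2)\<close>. In the coordinates \<open>(s, t, w)\<close> the induced metric is
  \<open>diag (- W\<^sup>2, s\<^sup>2, s\<^sup>2 cosh\<^sup>2 t)\<close> and the shape operator is \<open>diag (a, b, b)\<close> with \<open>a = f'' / W\<^sup>3\<close>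
  and \<open>b = f' / (s W)\<close>, so \<open>P\<^sub>2 = diag (b\<^sup>2, a b, a b)\<close>. Every component of the Gauss map is a product
  \<open>\<alpha>(s) e(t, w)\<close> where \<open>e\<close> is either constant or a coordinate of the hyperbolic plane, hence an
  eigenfunction of its Laplacian with eigenvalue \<open>0\<close> or \<open>2\<close>. So \<open>L\<^sub>2\<close> acts on each component as a
  second order operator in \<open>s\<close>. On the first three components it is multiplication by a function \<open>m\<close>;
  as \<open>b\<close> contains the factor \<open>f'\<close>, this \<open>m\<close> is smooth also at the zeros of \<open>f'\<close>. On the last
  component, \<open>L\<^sub>2 N = m (N + C)\<close> is the differential equation up to the factor \<open>s\<^sup>3 W\<^sup>9\<close>.
\<close>

section \<open>Maps of class \<open>C\<^sup>k\<close>\<close>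

text \<open>\<open>frechet_derivative\<close> chooses some derivative at the point, so equality
  follows once both maps have exactly the same derivatives there. This covers points of
  non-differentiability as well.\<close>

lemma frechet_derivative_cong_open:
  assumes "open U" "x \<in> U" "\<And>y. y \<in> U \<Longrightarrow> h y = h' y"
  shows "frechet_derivative h (at x) = frechet_derivative h' (at x)"
proof -
  have "(h has_derivative D) (at x) \<longleftrightarrow> (h' has_derivative D) (at x)" for D
    using assms by (metis has_derivative_transform_within_open)
  then show ?thesis
    by (simp add: frechet_derivative_def)
qed

lemma Ck_on_cong:
  assumes "open U" "\<And>x. x \<in> U \<Longrightarrow> h x = h' x"
  shows "Ck_on k U h \<longleftrightarrow> Ck_on k U h'"
  using assms(2)
proof (induction k arbitrary: h h')
  case 0
  then show ?case by (simp cong: continuous_on_cong)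
next
  case (Suc k)
  have "h differentiable (at x) \<longleftrightarrow> h' differentiable (at x)" if "x \<in> U" for x
    using Suc.prems assms(1) that
    unfolding differentiable_def by (metis has_derivative_transform_within_open)
  moreover have "frechet_derivative h (at x) = frechet_derivative h' (at x)" if "x \<in> U" for x
    using frechet_derivative_cong_open[OF assms(1) that] Suc.prems by blast
  ultimately show ?case
    using Suc.IH[of "\<lambda>x. frechet_derivative h (at x) b" "\<lambda>x. frechet_derivative h' (at x) b" for b]
    by simp
qed

text \<open>Lets the closure proofs below work with an explicit formula \<open>D\<close> for the
  derivative: by uniqueness it agrees on \<open>U\<close> with the \<open>frechet_derivative\<close>
  of the recursion.\<close>

lemma Ck_on_SucI:
  assumes "open U" "\<And>x. x \<in> U \<Longrightarrow> (h has_derivative D x) (at x)"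
    and "\<And>b. b \<in> Basis \<Longrightarrow> Ck_on k U (\<lambda>x. D x b)"
  shows "Ck_on (Suc k) U h"
proof -
  have "frechet_derivative h (at x) = D x" if "x \<in> U" for x
    using assms(2)[OF that] by (metis frechet_derivative_at)
  then have "Ck_on k U (\<lambda>x. frechet_derivative h (at x) b)" if "b \<in> Basis" for b
    using Ck_on_cong[OF assms(1), of "\<lambda>x. frechet_derivative h (at x) b" "\<lambda>x. D x b"]
      assms(3)[OF that] by simp
  then show ?thesis
    using assms(2) by (auto simp: differentiable_def)
qed

lemma Ck_on_SucD: "Ck_on (Suc k) U h \<Longrightarrow> Ck_on k U h"
proof (induction k arbitrary: h)
  case 0
  then show ?case
    by (auto intro!: continuous_at_imp_continuous_on differentiable_imp_continuous_within)
next
  case (Suc k)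
  then show ?case by (metis Ck_on.simps(2))
qed

lemma Ck_on_Suc_has_derivative:
  assumes "Ck_on (Suc k) U h" "x \<in> U"
  shows "(h has_derivative frechet_derivative h (at x)) (at x)"
  using assms by (simp add: frechet_derivative_works)

lemma Ck_on_const: "open U \<Longrightarrow> Ck_on k U (\<lambda>x. c)"
proof (induction k arbitrary: c)
  case (Suc k)
  then show ?case
    by (intro Ck_on_SucI[where D = "\<lambda>x v. 0"]) auto
qed simp

lemma Ck_on_linear:
  assumes "open U" "bounded_linear h"
  shows "Ck_on k U h"
proof (cases k)
  case 0
  then show ?thesis
    using assms(2) by (simp add: linear_continuous_on)
next
  case (Suc l)
  show ?thesis
    unfolding Suc
    by (intro Ck_on_SucI[where D = "\<lambda>x. h"] assms(1) Ck_on_const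
        bounded_linear_imp_has_derivative assms(2))
qed

lemma Ck_on_linear_comp:
  assumes "open U" "bounded_linear l" "Ck_on k U h"
  shows "Ck_on k U (\<lambda>x. l (h x))"
  using assms(3)
proof (induction k arbitrary: h)
  case 0
  then show ?case
    using assms(2) by (auto intro: bounded_linear.continuous_on)
next
  case (Suc k)
  show ?case
  proof (rule Ck_on_SucI[where
        D = "\<lambda>x v. l (frechet_derivative h (at x) v)"])
    show "((\<lambda>x. l (h x)) has_derivative (\<lambda>v. l (frechet_derivative h (at x) v))) (at x)"
      if "x \<in> U" for x
      by (rule bounded_linear.has_derivative[OF assms(2) Ck_on_Suc_has_derivative[OF Suc.prems that]])
  qed (use Suc assms in auto)
qed

lemma Ck_on_add:
  assumes "open U" "Ck_on k U g" "Ck_on k U h"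
  shows "Ck_on k U (\<lambda>x. g x + h x)"
  using assms(2,3)
proof (induction k arbitrary: g h)
  case 0
  then show ?case by (simp add: continuous_on_add)
next
  case (Suc k)
  show ?case
  proof (rule Ck_on_SucI[where
        D = "\<lambda>x v. frechet_derivative g (at x) v + frechet_derivative h (at x) v"])
    show "((\<lambda>x. g x + h x) has_derivative
        (\<lambda>v. frechet_derivative g (at x) v + frechet_derivative h (at x) v)) (at x)"
      if "x \<in> U" for x
      by (intro has_derivative_add Ck_on_Suc_has_derivative[OF Suc.prems(1) that]
          Ck_on_Suc_has_derivative[OF Suc.prems(2) that])
  qed (use Suc assms(1) in auto)
qed

lemma Ck_on_sum:
  assumes "open U" "\<And>i. i \<in> A \<Longrightarrow> Ck_on k U (h i)"
  shows "Ck_on k U (\<lambda>x. \<Sum>i\<in>A. h i x)"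
  using assms(2)
  by (induction A rule: infinite_finite_induct) (auto intro: Ck_on_const Ck_on_add assms(1))

text \<open>The product rule leaves one factor undifferentiated in each summand, so the induction
  hypothesis is applied to \<open>g\<close> and \<open>h\<close> themselves after lowering their
  order with \<open>Ck_on_SucD\<close>.\<close>

lemma Ck_on_mult:
  fixes g h :: "'a::euclidean_space \<Rightarrow> real"
  assumes "open U" "Ck_on k U g" "Ck_on k U h"
  shows "Ck_on k U (\<lambda>x. g x * h x)"
  using assms(2,3)
proof (induction k arbitrary: g h)
  case 0
  then show ?case by (simp add: continuous_on_mult)
next
  case (Suc k)
  show ?case
  proof (rule Ck_on_SucI[where
        D = "\<lambda>x v. g x * frechet_derivative h (at x) v + frechet_derivative g (at x) v * h x"])
    show "((\<lambda>x. g x * h x) has_derivative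
        (\<lambda>v. g x * frechet_derivative h (at x) v + frechet_derivative g (at x) v * h x)) (at x)"
      if "x \<in> U" for x
      by (intro has_derivative_mult Ck_on_Suc_has_derivative[OF Suc.prems(1) that]
          Ck_on_Suc_has_derivative[OF Suc.prems(2) that])
    show "Ck_on k U (\<lambda>x. g x * frechet_derivative h (at x) b + frechet_derivative g (at x) b * h x)"
      if "b \<in> Basis" for b
      using Suc.prems that
      by (intro Ck_on_add assms(1) Suc.IH) (auto simp del: Ck_on.simps(2) dest: Ck_on_SucD, auto)
  qed (rule assms(1))
qed

text \<open>A linear map on the reals is determined by its value at 1. This translates between
  Frechet derivatives and derivatives as numbers.\<close>

lemma has_derivative_real_scale:
  fixes g :: "real \<Rightarrow> real"
  assumes "(g has_derivative D) (at y)"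
  shows "D v = D 1 * v"
  using linear_scale[OF has_derivative_linear[OF assms], of v 1] by simp

text \<open>By the chain rule the derivative is a product whose first factor is again a composition
  with the same \<open>h\<close>. Hence the induction varies \<open>g\<close> and keeps
  \<open>h\<close> fixed.\<close>

lemma Ck_on_compose:
  fixes g :: "real \<Rightarrow> real" and h :: "'a::euclidean_space \<Rightarrow> real"
  assumes "open U" "Ck_on k V g" "Ck_on k U h" "h ` U \<subseteq> V"
  shows "Ck_on k U (\<lambda>x. g (h x))"
  using assms(2,3)
proof (induction k arbitrary: g)
  case 0
  then show ?case
    using assms(4) by (auto intro: continuous_on_compose2)
next
  case (Suc k)
  show ?case
  proof (rule Ck_on_SucI[where
        D = "\<lambda>x v. frechet_derivative g (at (h x)) 1 * frechet_derivative h (at x) v"])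
    show "((\<lambda>x. g (h x)) has_derivative
        (\<lambda>v. frechet_derivative g (at (h x)) 1 * frechet_derivative h (at x) v)) (at x)"
      if "x \<in> U" for x
    proof -
      have g: "(g has_derivative frechet_derivative g (at (h x))) (at (h x))"
        using Ck_on_Suc_has_derivative[OF Suc.prems(1)] assms(4) that by blast
      show ?thesis
        by (rule has_derivative_eq_rhs
            [OF has_derivative_compose[OF Ck_on_Suc_has_derivative[OF Suc.prems(2) that] g]])
          (rule ext, rule has_derivative_real_scale[OF g])
    qed
    show "Ck_on k U (\<lambda>x. frechet_derivative g (at (h x)) 1 * frechet_derivative h (at x) b)"
      if "b \<in> Basis" for b
    proof (rule Ck_on_mult[OF assms(1)])
      show "Ck_on k U (\<lambda>x. frechet_derivative g (at (h x)) 1)"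
        using Suc.prems(1) Ck_on_SucD[OF Suc.prems(2)] by (rule_tac Suc.IH) simp_all
      show "Ck_on k U (\<lambda>x. frechet_derivative h (at x) b)"
        using Suc.prems(2) that by simp
    qed
  qed (rule assms(1))
qed

lemma Ck_on_real_SucI:
  fixes h :: "real \<Rightarrow> real"
  assumes "open U" "\<And>x. x \<in> U \<Longrightarrow> (h has_real_derivative h' x) (at x)" "Ck_on k U h'"
  shows "Ck_on (Suc k) U h"
  using assms
  by (intro Ck_on_SucI[where D = "\<lambda>x v. h' x * v"]) (auto simp: has_field_derivative_def)

section \<open>Smooth functions: algebraic operations, composition, square roots, hyperbolic
  functions\<close>

lemma smooth_on_const: "open U \<Longrightarrow> smooth_on U (\<lambda>x. c)"
  by (simp add: smooth_on_def Ck_on_const)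

lemma smooth_on_linear: "open U \<Longrightarrow> bounded_linear h \<Longrightarrow> smooth_on U h"
  by (simp add: smooth_on_def Ck_on_linear)

lemma smooth_on_add:
  "open U \<Longrightarrow> smooth_on U g \<Longrightarrow> smooth_on U h \<Longrightarrow> smooth_on U (\<lambda>x. g x + h x)"
  by (simp add: smooth_on_def Ck_on_add)

lemma smooth_on_mult:
  fixes g h :: "'a::euclidean_space \<Rightarrow> real"
  shows "open U \<Longrightarrow> smooth_on U g \<Longrightarrow> smooth_on U h \<Longrightarrow> smooth_on U (\<lambda>x. g x * h x)"
  by (simp add: smooth_on_def Ck_on_mult)

lemma smooth_on_minus:
  assumes "open U" "smooth_on U h"
  shows "smooth_on U (\<lambda>x. - h x)"
  using assms Ck_on_linear_comp[OF _ bounded_linear_minus[OF bounded_linear_ident]]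
  by (auto simp: smooth_on_def)

lemma smooth_on_diff:
  assumes "open U" "smooth_on U g" "smooth_on U h"
  shows "smooth_on U (\<lambda>x. g x - h x)"
  using smooth_on_add[OF assms(1,2) smooth_on_minus[OF assms(1,3)]] by simp

lemma smooth_on_power:
  fixes h :: "'a::euclidean_space \<Rightarrow> real"
  assumes "open U" "smooth_on U h"
  shows "smooth_on U (\<lambda>x. h x ^ n)"
  by (induction n) (simp_all add: smooth_on_const smooth_on_mult assms)

lemma smooth_on_compose:
  fixes g :: "real \<Rightarrow> real" and h :: "'a::euclidean_space \<Rightarrow> real"
  shows "open U \<Longrightarrow> smooth_on V g \<Longrightarrow> smooth_on U h \<Longrightarrow> h ` U \<subseteq> V \<Longrightarrow> smooth_on U (\<lambda>x. g (h x))"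
  unfolding smooth_on_def using Ck_on_compose by blast

text \<open>The derivative of \<open>inverse\<close> is a polynomial in \<open>inverse\<close>, so
  the induction on the order closes on itself. For \<open>sqrt\<close> below, the derivative is
  likewise expressed through \<open>sqrt\<close>.\<close>

lemma smooth_on_inverse_real: "smooth_on (- {0}) (inverse :: real \<Rightarrow> real)"
proof -
  have "Ck_on k (- {0}) (inverse :: real \<Rightarrow> real)" for k
  proof (induction k)
    case 0
    show ?case by (auto intro: continuous_intros)
  next
    case (Suc k)
    have "Ck_on k (- {0}) (\<lambda>x::real. - 1 * (inverse x * inverse x))"
      by (intro Ck_on_mult Ck_on_const Suc) auto
    then show ?case
      by (rule Ck_on_real_SucI[rotated 2]) (auto intro!: derivative_eq_intros simp: power2_eq_square)
  qed
  then show ?thesis by (simp add: smooth_on_def)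
qed

lemma smooth_on_inverse:
  fixes h :: "'a::euclidean_space \<Rightarrow> real"
  assumes "open U" "smooth_on U h" "\<And>x. x \<in> U \<Longrightarrow> h x \<noteq> 0"
  shows "smooth_on U (\<lambda>x. inverse (h x))"
  by (rule smooth_on_compose[OF assms(1) smooth_on_inverse_real assms(2)]) (use assms(3) in auto)

lemma smooth_on_divide:
  fixes g h :: "'a::euclidean_space \<Rightarrow> real"
  assumes "open U" "smooth_on U g" "smooth_on U h" "\<And>x. x \<in> U \<Longrightarrow> h x \<noteq> 0"
  shows "smooth_on U (\<lambda>x. g x / h x)"
  unfolding divide_inverse by (intro smooth_on_mult smooth_on_inverse assms)

lemma smooth_on_sqrt_real: "smooth_on {0<..} sqrt"
proof -
  have "Ck_on k {0<..} sqrt" for k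
  proof (induction k)
    case 0
    show ?case by (auto intro: continuous_intros)
  next
    case (Suc k)
    have "Ck_on k {0<..} (\<lambda>x. inverse (sqrt x) * (1 / 2))"
      using smooth_on_inverse_real
      by (intro Ck_on_mult Ck_on_const Ck_on_compose[OF _ _ Suc, where V = "- {0}"])
        (auto simp: smooth_on_def)
    then show ?case
      by (rule Ck_on_real_SucI[rotated 2]) (auto intro!: derivative_eq_intros)
  qed
  then show ?thesis by (simp add: smooth_on_def)
qed

lemma smooth_on_sqrt:
  fixes h :: "'a::euclidean_space \<Rightarrow> real"
  assumes "open U" "smooth_on U h" "\<And>x. x \<in> U \<Longrightarrow> h x > 0"
  shows "smooth_on U (\<lambda>x. sqrt (h x))"
  by (rule smooth_on_compose[OF assms(1) smooth_on_sqrt_real assms(2)]) (use assms(3) in auto)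

text \<open>The two functions are each other's derivatives, hence the simultaneous
  induction.\<close>

lemma Ck_on_cosh_sinh_real:
  "Ck_on k UNIV (cosh :: real \<Rightarrow> real) \<and> Ck_on k UNIV (sinh :: real \<Rightarrow> real)"
proof (induction k)
  case 0
  show ?case by (auto intro: continuous_intros)
next
  case (Suc k)
  have "Ck_on (Suc k) UNIV (cosh :: real \<Rightarrow> real)"
    by (rule Ck_on_real_SucI[where h' = sinh]) (use Suc in \<open>auto intro!: derivative_eq_intros\<close>)
  moreover have "Ck_on (Suc k) UNIV (sinh :: real \<Rightarrow> real)"
    by (rule Ck_on_real_SucI[where h' = cosh]) (use Suc in \<open>auto intro!: derivative_eq_intros\<close>)
  ultimately show ?case by blast
qed

lemma smooth_on_componentwise:
  fixes h :: "'a::euclidean_space \<Rightarrow> real^'n"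
  assumes "open U" "\<And>i. smooth_on U (\<lambda>x. h x $ i)"
  shows "smooth_on U h"
proof -
  have "h = (\<lambda>x. \<Sum>i\<in>UNIV. h x $ i *\<^sub>R axis i 1)"
    by (auto simp: basis_expansion scalar_mult_eq_scaleR[symmetric])
  moreover have "Ck_on k U (\<lambda>x. \<Sum>i\<in>UNIV. h x $ i *\<^sub>R axis i (1::real))" for k
    using assms
    by (intro Ck_on_sum Ck_on_linear_comp[OF _ bounded_linear_scaleR_left]) (auto simp: smooth_on_def)
  ultimately show ?thesis by (auto simp: smooth_on_def)
qed

lemma smooth_on_has_derivative:
  assumes "smooth_on U h" "x \<in> U"
  shows "(h has_derivative frechet_derivative h (at x)) (at x)"
  using assms by (metis Ck_on_Suc_has_derivative smooth_on_def)

text \<open>On the real line the only basis vector is 1, so \<open>deriv\<close> is the single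
  partial derivative in \<open>Ck_on\<close> and inherits smoothness from it.\<close>

lemma smooth_on_real_deriv:
  fixes h :: "real \<Rightarrow> real"
  assumes "open U" "smooth_on U h"
  shows "x \<in> U \<Longrightarrow> (h has_real_derivative deriv h x) (at x)" and "smooth_on U (deriv h)"
proof -
  have D: "(h has_real_derivative frechet_derivative h (at x) 1) (at x)" if "x \<in> U" for x
  proof -
    note d = smooth_on_has_derivative[OF assms(2) that]
    show ?thesis
      unfolding has_field_derivative_def
      by (rule has_derivative_eq_rhs[OF d]) (rule ext, rule has_derivative_real_scale[OF d])
  qed
  then have eq: "deriv h x = frechet_derivative h (at x) 1" if "x \<in> U" for x
    using that by (metis DERIV_imp_deriv)
  show "x \<in> U \<Longrightarrow> (h has_real_derivative deriv h x) (at x)"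
    using D eq by simp
  have "Ck_on (Suc k) U h" for k
    using assms(2) by (simp add: smooth_on_def del: Ck_on.simps)
  then have "Ck_on k U (\<lambda>x. frechet_derivative h (at x) 1)" for k
    by simp
  then show "smooth_on U (deriv h)"
    using Ck_on_cong[OF assms(1) eq] by (simp add: smooth_on_def)
qed

section \<open>Diagonal matrices and diagonal metrics\<close>

definition diagm :: "('n \<Rightarrow> real) \<Rightarrow> real^'n^'n" where
  "diagm d = (\<chi> i j. if i = j then d i else 0)"

lemma diagm_nth: "diagm d $ i $ j = (if i = j then d i else 0)"
  by (simp add: diagm_def)

lemma sum_diagm_mult: "(\<Sum>k\<in>UNIV. diagm d $ i $ k * x k) = d i * x (i::'n::finite)"
proof -
  have "(\<Sum>k\<in>UNIV. diagm d $ i $ k * x k) = (\<Sum>k\<in>UNIV. if i = k then d i * x i else 0)"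
    by (rule sum.cong) (auto simp: diagm_nth)
  then show ?thesis by simp
qed

lemma diagm_mult: "diagm d ** diagm e = diagm (\<lambda>i::'n::finite. d i * e i)"
  by (simp add: vec_eq_iff matrix_matrix_mult_def sum_diagm_mult) (simp add: diagm_nth)

lemma mat_eq_diagm: "mat c = diagm (\<lambda>_. c)"
  by (simp add: mat_def diagm_def)

lemma diagm_add: "diagm d + diagm e = diagm (\<lambda>i. d i + e i)"
  by (simp add: vec_eq_iff diagm_nth)

lemma diagm_diff: "diagm d - diagm e = diagm (\<lambda>i. d i - e i)"
  by (simp add: vec_eq_iff diagm_nth)

lemma prod_UNIV_3: "(\<Prod>i\<in>UNIV. h i) = h 1 * h 2 * h (3::3)"
  for h :: "3 \<Rightarrow> 'a::comm_monoid_mult"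
  unfolding UNIV_3 by (simp add: ac_simps)

lemma det_diagm: "det (diagm d) = (\<Prod>i\<in>UNIV. d i)"
  by (subst det_diagonal) (auto simp: diagm_nth)

lemma trace_diagm_mult: "trace (diagm d ** A) = (\<Sum>i\<in>UNIV. d i * A $ i $ i)"
  by (simp add: trace_def matrix_matrix_mult_def sum_diagm_mult)

lemma matrix_inv_diagm:
  fixes d :: "'n::finite \<Rightarrow> real"
  assumes "\<And>i. d i \<noteq> 0"
  shows "matrix_inv (diagm d) = diagm (\<lambda>i. inverse (d i))"
proof -
  let ?e = "diagm (\<lambda>i. inverse (d i))"
  have e: "diagm d ** ?e = mat 1" "?e ** diagm d = mat 1"
    using assms by (simp_all add: diagm_mult mat_eq_diagm)
  \<comment> \<open>\<open>matrix_inv\<close> is a choice. Knowing that the chosen matrix is a right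
    inverse suffices: multiplication by \<open>?e\<close> from the left identifies it.\<close>
  then have "diagm d ** matrix_inv (diagm d) = mat 1"
    unfolding matrix_inv_def
    by (rule_tac someI2[where a = ?e and Q = "\<lambda>M. diagm d ** M = mat 1"]) auto
  then show ?thesis
    by (metis e(2) matrix_mul_assoc matrix_mul_lid matrix_mul_rid)
qed

lemma vector_4_nth [simp]:
  "(vector [x, y, z, u] :: 'a::zero^4) $ 1 = x"
  "(vector [x, y, z, u] :: 'a::zero^4) $ 2 = y"
  "(vector [x, y, z, u] :: 'a::zero^4) $ 3 = z"
  "(vector [x, y, z, u] :: 'a::zero^4) $ 4 = u"
  unfolding vector_def by simp_all

section \<open>Partial derivatives, shape operator and Hessian in an orthogonal coordinate
  frame\<close>

lemma pderiv_at_eqI: "(h has_derivative D) (at p) \<Longrightarrow> pderiv_at i h p = D (axis i 1)"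
  unfolding pderiv_at_def by (metis frechet_derivative_at)

lemma pderiv_at_cong:
  assumes "open U" "p \<in> U" "\<And>q. q \<in> U \<Longrightarrow> g q = h q"
  shows "pderiv_at i g p = pderiv_at i h p"
  unfolding pderiv_at_def using frechet_derivative_cong_open[OF assms] by simp

lemma pderiv_at_nth:
  fixes h :: "real^3 \<Rightarrow> real^'n"
  assumes "smooth_on U h" "p \<in> U"
  shows "pderiv_at i h p $ k = pderiv_at i (\<lambda>q. h q $ k) p"
  using pderiv_at_eqI[OF bounded_linear.has_derivative
      [OF bounded_linear_vec_nth smooth_on_has_derivative[OF assms]]]
  by (simp add: pderiv_at_def)

lemma lorentz_sum_scaleR:
  "lorentz (\<Sum>i\<in>A. c i *\<^sub>R x i) y = (\<Sum>i\<in>A. c i * lorentz (x i) y)"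
  by (induction A rule: infinite_finite_induct) (auto simp: lorentz_def algebra_simps)

text \<open>The coordinate directions are principal directions. The nondegenerate diagonal metric
  gives the uniqueness that the definite description in \<open>shape_op\<close> requires.\<close>

lemma shape_op_eq_diagm:
  assumes "metric X p = diagm d" "\<And>i. d i \<noteq> 0"
    and "\<And>j. - pderiv_at j N p = \<kappa> j *\<^sub>R pderiv_at j X p"
  shows "shape_op X N p = diagm \<kappa>"
  unfolding shape_op_def
proof (rule the_equality)
  show "\<forall>j. - pderiv_at j N p = (\<Sum>i\<in>UNIV. diagm \<kappa> $ i $ j *\<^sub>R pderiv_at i X p)"
  proof
    fix j
    have "(\<Sum>i\<in>UNIV. diagm \<kappa> $ i $ j *\<^sub>R pderiv_at i X p) =
        (\<Sum>i\<in>UNIV. if i = j then \<kappa> i *\<^sub>R pderiv_at i X p else 0)"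
      by (rule sum.cong) (auto simp: diagm_nth)
    then show "- pderiv_at j N p = (\<Sum>i\<in>UNIV. diagm \<kappa> $ i $ j *\<^sub>R pderiv_at i X p)"
      using assms(3) by simp
  qed
next
  fix A :: "real^3^3"
  assume A: "\<forall>j. - pderiv_at j N p = (\<Sum>i\<in>UNIV. A $ i $ j *\<^sub>R pderiv_at i X p)"
  have g: "lorentz (pderiv_at i X p) (pderiv_at l X p) = (if i = l then d i else 0)" for i l
    using arg_cong[OF assms(1), of "\<lambda>M. M $ i $ l"] by (simp add: metric_def diagm_nth)
  \<comment> \<open>Pairing both expansions of \<open>- pderiv_at j N p\<close> with
    \<open>pderiv_at l X p\<close> isolates the coefficient, because the frame is orthogonal and
    \<open>d l\<close> is nonzero.\<close>
  have "A $ l $ j = diagm \<kappa> $ l $ j" for l j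
  proof -
    have "(\<Sum>i\<in>UNIV. A $ i $ j *\<^sub>R pderiv_at i X p) = (\<Sum>i\<in>{j}. \<kappa> i *\<^sub>R pderiv_at i X p)"
      using A assms(3) by simp
    then have "(\<Sum>i\<in>UNIV. A $ i $ j * lorentz (pderiv_at i X p) (pderiv_at l X p)) =
        (\<Sum>i\<in>{j}. \<kappa> i * lorentz (pderiv_at i X p) (pderiv_at l X p))"
      by (simp only: lorentz_sum_scaleR[symmetric])
    then have "A $ l $ j * d l = (if l = j then \<kappa> l * d l else 0)"
      by (auto simp: g if_distrib cong: if_cong split: if_splits)
    then show ?thesis
      using assms(2)[of l] by (cases "l = j") (simp_all add: diagm_nth)
  qed
  then show "A = diagm \<kappa>" by (simp add: vec_eq_iff)
qed

(* The order of the principal curvatures is an arbitrary choice; three values of the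
   characteristic polynomial already determine the symmetric functions. *)
lemma curv_coeff_diagm:
  assumes "shape_op X N p = diagm \<kappa>"
  shows "curv_coeff X N 1 p = - (\<kappa> 1 + \<kappa> 2 + \<kappa> 3)"
    and "curv_coeff X N 2 p = \<kappa> 1 * \<kappa> 2 + \<kappa> 1 * \<kappa> 3 + \<kappa> 2 * \<kappa> 3"
proof -
  define c where "c = principal_curvatures X N p"
  have det: "det (mat z - shape_op X N p) = (z - \<kappa> 1) * (z - \<kappa> 2) * (z - \<kappa> 3)" for z
    by (simp only: assms mat_eq_diagm diagm_diff det_diagm prod_UNIV_3)
  \<comment> \<open>The diagonal entries are a witness that the characteristic polynomial splits
    over the reals, so the choice in \<open>principal_curvatures\<close> has the intended
    property.\<close>
  have "\<forall>z. det (mat z - shape_op X N p) = (z - c $ 1) * (z - c $ 2) * (z - c $ 3)"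
    unfolding c_def principal_curvatures_def
    by (rule someI[where x = "vector [\<kappa> 1, \<kappa> 2, \<kappa> 3]"]) (simp add: det vector_3)
  then have eq: "(z - \<kappa> 1) * (z - \<kappa> 2) * (z - \<kappa> 3) = (z - c $ 1) * (z - c $ 2) * (z - c $ 3)" for z
    using det by simp
  have expand: "(z - x) * (z - y) * (z - u) =
      z ^ 3 - (x + y + u) * z\<^sup>2 + (x * y + x * u + y * u) * z - x * y * u" for x y z u :: real
    by (simp add: algebra_simps power2_eq_square power3_eq_cube)
  have "c $ 1 + c $ 2 + c $ 3 = \<kappa> 1 + \<kappa> 2 + \<kappa> 3"
    and "c $ 1 * c $ 2 + c $ 1 * c $ 3 + c $ 2 * c $ 3 = \<kappa> 1 * \<kappa> 2 + \<kappa> 1 * \<kappa> 3 + \<kappa> 2 * \<kappa> 3"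
    \<comment> \<open>The value at 0 matches the products of the three roots. The values at 1 and -1
      are then linear equations for the other two symmetric functions.\<close>
    using eq[unfolded expand, of 0, simplified] eq[unfolded expand, of 1] eq[unfolded expand, of "-1"]
    unfolding power_one power_minus_Bit0 power_minus_Bit1 mult_1_right mult_minus1_right
    by - linarith+
  then show "curv_coeff X N 1 p = - (\<kappa> 1 + \<kappa> 2 + \<kappa> 3)"
    and "curv_coeff X N 2 p = \<kappa> 1 * \<kappa> 2 + \<kappa> 1 * \<kappa> 3 + \<kappa> 2 * \<kappa> 3"
    unfolding curv_coeff_def c_def[symmetric] Let_def by simp_all
qed

text \<open>The \<open>i\<close>-th entry is the product of the two principal curvatures other than
  \<open>\<kappa> i\<close>, left in the form that the recursion produces.\<close>

lemma newton_2_diagm: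
  assumes "shape_op X N p = diagm \<kappa>"
  shows "newton X N 2 p = diagm (\<lambda>i. \<kappa> 1 * \<kappa> 2 + \<kappa> 1 * \<kappa> 3 + \<kappa> 2 * \<kappa> 3
            + \<kappa> i * (\<kappa> i - (\<kappa> 1 + \<kappa> 2 + \<kappa> 3)))"
proof -
  have "newton X N 2 p = mat (curv_coeff X N 2 p)
      + shape_op X N p ** (mat (curv_coeff X N 1 p) + shape_op X N p ** mat 1)"
    by (simp add: numeral_2_eq_2)
  then show ?thesis
    unfolding curv_coeff_diagm[OF assms] assms mat_eq_diagm diagm_mult diagm_add
    by (simp add: algebra_simps)
qed

text \<open>Diagonal entries are enough for \<open>L_op\<close> when the Newton transformation is
  diagonal, since the trace then involves no others.\<close>

lemma hessian_op_diagonal_entry: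
  assumes U: "open U" "p \<in> U"
    and metric: "\<And>q. q \<in> U \<Longrightarrow> metric X q = diagm (d q)"
    and d: "\<And>q i. q \<in> U \<Longrightarrow> d q i \<noteq> 0"
  shows "hessian_op X \<phi> p $ i $ i =
      pderiv_at i (\<lambda>q. pderiv_at i \<phi> q / d q i) p
      + (\<Sum>k\<in>UNIV. pderiv_at k (\<lambda>q. d q i) p * (pderiv_at k \<phi> p / d p k)) / (2 * d p i)"
proof -
  have inv: "matrix_inv (metric X q) = diagm (\<lambda>i. inverse (d q i))" if "q \<in> U" for q
    using metric[OF that] matrix_inv_diagm[of "d q"] d[OF that] by simp
  have grad: "gradient X \<phi> q $ k = pderiv_at k \<phi> q / d q k" if "q \<in> U" for q k
    by (simp add: gradient_def inv[OF that] sum_diagm_mult divide_inverse_commute)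
  have g: "pderiv_at k (\<lambda>q. metric X q $ a $ b) p = (if a = b then pderiv_at k (\<lambda>q. d q a) p else 0)"
    for k a b
  proof -
    have "pderiv_at k (\<lambda>q. metric X q $ a $ b) p = pderiv_at k (\<lambda>q. if a = b then d q a else 0) p"
      by (rule pderiv_at_cong[OF U]) (simp add: metric diagm_nth)
    also have "\<dots> = (if a = b then pderiv_at k (\<lambda>q. d q a) p else 0)"
      by (simp add: pderiv_at_eqI[OF has_derivative_const])
    finally show ?thesis .
  qed
  \<comment> \<open>Only the summand \<open>l = i\<close> survives. Its first and last derivatives
    vanish for \<open>k\<close> different from \<open>i\<close> and cancel for
    \<open>k = i\<close>.\<close>
  have "christoffel X i i k p = pderiv_at k (\<lambda>q. d q i) p / (2 * d p i)" for k
    unfolding christoffel_def inv[OF U(2)] g sum_diagm_mult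
    by (cases "k = i") (simp_all add: field_simps)
  then have "(\<Sum>k\<in>UNIV. christoffel X i i k p * gradient X \<phi> p $ k) =
      (\<Sum>k\<in>UNIV. pderiv_at k (\<lambda>q. d q i) p * (pderiv_at k \<phi> p / d p k)) / (2 * d p i)"
    by (simp add: grad[OF U(2)] sum_divide_distrib mult.commute)
  moreover have "pderiv_at i (\<lambda>q. gradient X \<phi> q $ i) p = pderiv_at i (\<lambda>q. pderiv_at i \<phi> q / d q i) p"
    by (rule pderiv_at_cong[OF U]) (rule grad)
  ultimately show ?thesis
    by (simp add: hessian_op_def)
qed

text \<open>The components of the immersion and of the Gauss map and the metric coefficients all
  have this form, so their partial derivatives reduce to ordinary ones.\<close>

definition sep :: "(real \<Rightarrow> real) \<Rightarrow> (real \<Rightarrow> real) \<Rightarrow> (real \<Rightarrow> real) \<Rightarrow> real^3 \<Rightarrow> real" where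
  "sep \<alpha> \<beta> \<gamma> = (\<lambda>q. \<alpha> (q $ 1) * \<beta> (q $ 2) * \<gamma> (q $ 3))"

lemma pderiv_at_sep:
  assumes "(\<alpha> has_real_derivative \<alpha>') (at (p $ 1))"
    and "(\<beta> has_real_derivative \<beta>') (at (p $ 2))"
    and "(\<gamma> has_real_derivative \<gamma>') (at (p $ 3))"
  shows "pderiv_at 1 (sep \<alpha> \<beta> \<gamma>) p = \<alpha>' * \<beta> (p $ 2) * \<gamma> (p $ 3)"
    and "pderiv_at 2 (sep \<alpha> \<beta> \<gamma>) p = \<alpha> (p $ 1) * \<beta>' * \<gamma> (p $ 3)"
    and "pderiv_at 3 (sep \<alpha> \<beta> \<gamma>) p = \<alpha> (p $ 1) * \<beta> (p $ 2) * \<gamma>'"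
proof -
  have c: "((\<lambda>q. h (q $ k)) has_derivative (\<lambda>v. h' * v $ k)) (at p)"
    if "(h has_real_derivative h') (at (p $ k))" for h h' and k :: 3
    using has_derivative_compose[OF bounded_linear_imp_has_derivative[OF bounded_linear_vec_nth]
        that[unfolded has_field_derivative_def]] .
  have "(sep \<alpha> \<beta> \<gamma> has_derivative
      (\<lambda>v. \<alpha> (p $ 1) * \<beta> (p $ 2) * (\<gamma>' * v $ 3) +
        (\<alpha> (p $ 1) * (\<beta>' * v $ 2) + \<alpha>' * v $ 1 * \<beta> (p $ 2)) * \<gamma> (p $ 3))) (at p)"
    unfolding sep_def by (intro has_derivative_mult c assms)
  note D = pderiv_at_eqI[OF this]
  show "pderiv_at 1 (sep \<alpha> \<beta> \<gamma>) p = \<alpha>' * \<beta> (p $ 2) * \<gamma> (p $ 3)"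
    by (simp add: D[of 1] axis_def)
  show "pderiv_at 2 (sep \<alpha> \<beta> \<gamma>) p = \<alpha> (p $ 1) * \<beta>' * \<gamma> (p $ 3)"
    by (simp add: D[of 2] axis_def)
  show "pderiv_at 3 (sep \<alpha> \<beta> \<gamma>) p = \<alpha> (p $ 1) * \<beta> (p $ 2) * \<gamma>'"
    by (simp add: D[of 3] axis_def)
qed

section \<open>The rotational hypersurface\<close>

lemma open_rot_domain: "open I \<Longrightarrow> open (rot_domain I)"
  unfolding rot_domain_def
  by (rule open_vimage[of I "\<lambda>p. p $ 1", unfolded vimage_def]) (auto intro: continuous_intros)

lemma smooth_on_nth: "open U \<Longrightarrow> smooth_on U (\<lambda>p::real^'n. p $ k)"
  by (simp add: smooth_on_linear bounded_linear_vec_nth)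

text \<open>The bound on the slope makes the normal direction spacelike, which explains the name
  \<open>spacelike\<close>; it also makes \<open>W\<close> below positive.\<close>

locale rotational =
  fixes I :: "real set" and f :: "real \<Rightarrow> real"
  assumes open_I: "open I" and zero_notin: "0 \<notin> I" and smooth_f: "smooth_on I f"
    and spacelike: "\<And>s. s \<in> I \<Longrightarrow> (deriv f s)\<^sup>2 < 1"
begin

abbreviation f1 :: "real \<Rightarrow> real" where "f1 \<equiv> deriv f"
abbreviation f2 :: "real \<Rightarrow> real" where "f2 \<equiv> deriv f1"
abbreviation f3 :: "real \<Rightarrow> real" where "f3 \<equiv> deriv f2"
abbreviation X :: "real^3 \<Rightarrow> real^4" where "X \<equiv> rot_hypersurface f"
abbreviation N :: "real^3 \<Rightarrow> real^4" where "N \<equiv> rot_gauss f"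
abbreviation U :: "(real^3) set" where "U \<equiv> rot_domain I"

definition W :: "real \<Rightarrow> real" where "W s = sqrt (1 - (f1 s)\<^sup>2)"

lemma W_pos: "s \<in> I \<Longrightarrow> W s > 0"
  using spacelike by (simp add: W_def)

lemma W_sq: "s \<in> I \<Longrightarrow> (W s)\<^sup>2 = 1 - (f1 s)\<^sup>2"
  using spacelike[of s] by (simp add: W_def)

lemma open_U: "open U"
  by (rule open_rot_domain[OF open_I])

lemma U_D: "p \<in> U \<Longrightarrow> p $ 1 \<in> I"
  by (simp add: rot_domain_def)

lemma nonzero: "s \<in> I \<Longrightarrow> s \<noteq> 0"
  using zero_notin by blast

lemma smooth_f1: "smooth_on I f1" and smooth_f2: "smooth_on I f2" and smooth_f3: "smooth_on I f3"
  using smooth_on_real_deriv(2)[OF open_I] smooth_f by blast+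

lemmas DERIV_f = smooth_on_real_deriv(1)[OF open_I smooth_f]
lemmas DERIV_f1 = smooth_on_real_deriv(1)[OF open_I smooth_f1]
lemmas DERIV_f2 = smooth_on_real_deriv(1)[OF open_I smooth_f2]

lemma DERIV_W:
  assumes "s \<in> I"
  shows "(W has_real_derivative - (f1 s * f2 s / W s)) (at s)"
proof -
  have "((\<lambda>s. sqrt (1 - (f1 s)\<^sup>2)) has_real_derivative - (f1 s * f2 s / W s)) (at s)"
    using DERIV_f1[OF assms] spacelike[OF assms]
    by (auto intro!: derivative_eq_intros simp: W_def field_simps)
  then show ?thesis by (simp add: W_def[abs_def])
qed

lemma smooth_on_coord:
  fixes h :: "real \<Rightarrow> real"
  assumes "smooth_on I h"
  shows "smooth_on U (\<lambda>p. h (p $ 1))"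
  by (rule smooth_on_compose[OF open_U assms smooth_on_nth[OF open_U]]) (auto dest: U_D)

lemma smooth_W: "smooth_on I W"
  unfolding W_def[abs_def] using spacelike
  by (intro smooth_on_sqrt smooth_on_diff smooth_on_power smooth_on_const smooth_f1 open_I) auto

lemma smooth_on_sep:
  assumes "smooth_on I \<alpha>" "smooth_on UNIV \<beta>" "smooth_on UNIV \<gamma>"
  shows "smooth_on U (sep \<alpha> \<beta> \<gamma>)"
  unfolding sep_def
  by (intro smooth_on_mult open_U smooth_on_coord assms
      smooth_on_compose[OF open_U assms(2) smooth_on_nth[OF open_U]]
      smooth_on_compose[OF open_U assms(3) smooth_on_nth[OF open_U]]) auto

section \<open>Radial factors of the Gauss map and their derivatives\<close>

definition \<alpha> :: "real \<Rightarrow> real" where "\<alpha> s = - (f1 s / W s)"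
definition \<alpha>1 :: "real \<Rightarrow> real" where "\<alpha>1 s = - (f2 s / W s ^ 3)"
definition \<beta> :: "real \<Rightarrow> real" where "\<beta> s = - (1 / W s)"
definition \<beta>1 :: "real \<Rightarrow> real" where "\<beta>1 s = - (f1 s * f2 s / W s ^ 3)"

lemma smooth_\<alpha>: "smooth_on I \<alpha>" and smooth_\<beta>: "smooth_on I \<beta>"
  unfolding \<alpha>_def[abs_def] \<beta>_def[abs_def] using W_pos
  by (intro smooth_on_minus smooth_on_divide smooth_on_const smooth_f1 smooth_W open_I; force)+

text \<open>The quotient rule gives the numerator
  \<open>f2 s * ((W s)\<^sup>2 + (f1 s)\<^sup>2)\<close> up to sign, and the bracket equals
  1.\<close>

lemma DERIV_\<alpha>:
  assumes "s \<in> I"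
  shows "(\<alpha> has_real_derivative \<alpha>1 s) (at s)"
  unfolding \<alpha>_def[abs_def] \<alpha>1_def
  apply (insert W_pos[OF assms] W_sq[OF assms])
  apply (rule derivative_eq_intros DERIV_W[OF assms] DERIV_f1[OF assms] refl | simp)+
  apply (simp add: divide_simps)
  apply algebra
  done

lemma DERIV_\<alpha>1:
  assumes "s \<in> I"
  shows "(\<alpha>1 has_real_derivative - (f3 s / W s ^ 3 + 3 * f1 s * (f2 s)\<^sup>2 / W s ^ 5)) (at s)"
  unfolding \<alpha>1_def[abs_def]
  apply (insert W_pos[OF assms])
  apply (rule derivative_eq_intros DERIV_W[OF assms] DERIV_f2[OF assms] refl | simp)+
  apply (simp add: divide_simps)
  apply algebra
  done

lemma DERIV_\<beta>:
  assumes "s \<in> I"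
  shows "(\<beta> has_real_derivative \<beta>1 s) (at s)"
  unfolding \<beta>_def[abs_def] \<beta>1_def
  apply (insert W_pos[OF assms])
  apply (rule derivative_eq_intros DERIV_W[OF assms] refl | simp)+
  apply (simp add: divide_simps power3_eq_cube)
  done

lemma DERIV_\<beta>1:
  assumes "s \<in> I"
  shows "(\<beta>1 has_real_derivative
      - (((f2 s)\<^sup>2 + f1 s * f3 s) / W s ^ 3 + 3 * (f1 s)\<^sup>2 * (f2 s)\<^sup>2 / W s ^ 5)) (at s)"
  unfolding \<beta>1_def[abs_def]
  apply (insert W_pos[OF assms])
  apply (rule derivative_eq_intros DERIV_W[OF assms] DERIV_f1[OF assms] DERIV_f2[OF assms]
      refl | simp)+
  apply (simp add: divide_simps)
  apply algebra
  done

section \<open>The immersion and the Gauss map in separated form\<close>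

lemma X_nth:
  "(\<lambda>q. X q $ 1) = sep (\<lambda>s. s) cosh cosh"
  "(\<lambda>q. X q $ 2) = sep (\<lambda>s. s) sinh (\<lambda>_. 1)"
  "(\<lambda>q. X q $ 3) = sep (\<lambda>s. s) cosh sinh"
  "(\<lambda>q. X q $ 4) = sep f (\<lambda>_. 1) (\<lambda>_. 1)"
  by (simp_all add: fun_eq_iff rot_hypersurface_def sep_def Let_def)

lemma N_nth:
  "(\<lambda>q. N q $ 1) = sep \<alpha> cosh cosh"
  "(\<lambda>q. N q $ 2) = sep \<alpha> sinh (\<lambda>_. 1)"
  "(\<lambda>q. N q $ 3) = sep \<alpha> cosh sinh"
  "(\<lambda>q. N q $ 4) = sep \<beta> (\<lambda>_. 1) (\<lambda>_. 1)"
  by (simp_all add: fun_eq_iff rot_gauss_def sep_def Let_def \<alpha>_def \<beta>_def W_def)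

lemma smooth_on_hyperbolic:
  "smooth_on UNIV (cosh :: real \<Rightarrow> real)"
  "smooth_on UNIV (sinh :: real \<Rightarrow> real)"
  using Ck_on_cosh_sinh_real by (auto simp: smooth_on_def)

lemma smooth_X: "smooth_on U X"
proof (rule smooth_on_componentwise[OF open_U])
  have "smooth_on I (\<lambda>s. s)"
    by (rule smooth_on_linear[OF open_I bounded_linear_ident])
  then have "\<forall>i. smooth_on U (\<lambda>p. X p $ i)"
    unfolding forall_4 X_nth
    by (intro conjI smooth_on_sep smooth_f smooth_on_hyperbolic smooth_on_const open_UNIV)
  then show "smooth_on U (\<lambda>p. X p $ i)" for i
    by blast
qed

lemma smooth_N: "smooth_on U N"
proof (rule smooth_on_componentwise[OF open_U])
  have "\<forall>i. smooth_on U (\<lambda>p. N p $ i)"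
    unfolding forall_4 N_nth
    by (intro conjI smooth_on_sep smooth_\<alpha> smooth_\<beta> smooth_on_hyperbolic smooth_on_const open_UNIV)
  then show "smooth_on U (\<lambda>p. N p $ i)" for i
    by blast
qed

lemma DERIV_hyperbolic:
  "(cosh has_real_derivative sinh x) (at x)" "(sinh has_real_derivative cosh x) (at x)"
  "((\<lambda>_. 1) has_real_derivative 0) (at x)" for x :: real
  by (auto intro!: derivative_eq_intros)

text \<open>One instance for the angular factor of each of the four components, in their order; the
  radial derivative stays open so that the same rules serve \<open>X\<close> and
  \<open>N\<close>.\<close>

lemmas pderiv_at_hyperbolic =
  pderiv_at_sep[OF _ DERIV_hyperbolic(1) DERIV_hyperbolic(1)]
  pderiv_at_sep[OF _ DERIV_hyperbolic(2) DERIV_hyperbolic(3)]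
  pderiv_at_sep[OF _ DERIV_hyperbolic(1) DERIV_hyperbolic(2)]
  pderiv_at_sep[OF _ DERIV_hyperbolic(3) DERIV_hyperbolic(3)]

lemma pderiv_at_X:
  assumes "p \<in> U"
  shows "pderiv_at 1 X p = vector [cosh (p $ 2) * cosh (p $ 3), sinh (p $ 2),
          cosh (p $ 2) * sinh (p $ 3), f1 (p $ 1)]"
    and "pderiv_at 2 X p = vector [p $ 1 * sinh (p $ 2) * cosh (p $ 3), p $ 1 * cosh (p $ 2),
          p $ 1 * sinh (p $ 2) * sinh (p $ 3), 0]"
    and "pderiv_at 3 X p = vector [p $ 1 * cosh (p $ 2) * sinh (p $ 3), 0,
          p $ 1 * cosh (p $ 2) * cosh (p $ 3), 0]"
  unfolding vec_eq_iff forall_4 pderiv_at_nth[OF smooth_X assms] X_nth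
  by (simp_all add: pderiv_at_hyperbolic[OF DERIV_ident]
      pderiv_at_hyperbolic[OF DERIV_f[OF U_D[OF assms]]])

lemma pderiv_at_N:
  assumes "p \<in> U"
  shows "pderiv_at 1 N p = vector [\<alpha>1 (p $ 1) * cosh (p $ 2) * cosh (p $ 3),
          \<alpha>1 (p $ 1) * sinh (p $ 2),
          \<alpha>1 (p $ 1) * cosh (p $ 2) * sinh (p $ 3), \<beta>1 (p $ 1)]"
    and "pderiv_at 2 N p = vector [\<alpha> (p $ 1) * sinh (p $ 2) * cosh (p $ 3),
          \<alpha> (p $ 1) * cosh (p $ 2),
          \<alpha> (p $ 1) * sinh (p $ 2) * sinh (p $ 3), 0]"
    and "pderiv_at 3 N p = vector [\<alpha> (p $ 1) * cosh (p $ 2) * sinh (p $ 3), 0,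
          \<alpha> (p $ 1) * cosh (p $ 2) * cosh (p $ 3), 0]"
  unfolding vec_eq_iff forall_4 pderiv_at_nth[OF smooth_N assms] N_nth
  by (simp_all add: pderiv_at_hyperbolic[OF DERIV_\<alpha>[OF U_D[OF assms]]]
      pderiv_at_hyperbolic[OF DERIV_\<beta>[OF U_D[OF assms]]])

section \<open>Metric, shape operator and orientation\<close>

definition g :: "real^3 \<Rightarrow> 3 \<Rightarrow> real" where
  "g q i = (if i = 1 then sep (\<lambda>s. - (W s)\<^sup>2) (\<lambda>_. 1) (\<lambda>_. 1) q
     else if i = 2 then sep (\<lambda>s. s\<^sup>2) (\<lambda>_. 1) (\<lambda>_. 1) q
     else sep (\<lambda>s. s\<^sup>2) (\<lambda>t. (cosh t)\<^sup>2) (\<lambda>_. 1) q)"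

lemma cosh_sq: "(cosh t)\<^sup>2 = 1 + (sinh t)\<^sup>2" for t :: real
  by (simp add: cosh_square_eq)

lemma g_nonzero: "q \<in> U \<Longrightarrow> g q i \<noteq> 0"
  using W_pos[OF U_D, of q] nonzero[OF U_D, of q]
  by (auto simp: g_def sep_def)

lemma metric_X:
  assumes "q \<in> U"
  shows "metric X q = diagm (g q)"
proof -
  note h = cosh_sq[of "q $ 2"] cosh_sq[of "q $ 3"] W_sq[OF U_D[OF assms]]
  \<comment> \<open>After expansion every entry is a polynomial identity modulo the relations in
    \<open>h\<close>.\<close>
  show ?thesis
    unfolding vec_eq_iff forall_3 metric_def vec_lambda_beta diagm_nth pderiv_at_X[OF assms]
      lorentz_def vector_4_nth g_def sep_def
    apply simp
    apply (intro conjI)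
    using h apply algebra+
    done
qed

text \<open>The first value is the curvature in the profile direction; the other is shared by the
  two directions of rotation.\<close>

definition \<kappa> :: "real \<Rightarrow> 3 \<Rightarrow> real" where
  "\<kappa> s i = (if i = 1 then f2 s / W s ^ 3 else f1 s / (s * W s))"

lemma shape_op_rot:
  assumes "p \<in> U"
  shows "shape_op X N p = diagm (\<kappa> (p $ 1))"
proof (rule shape_op_eq_diagm[OF metric_X[OF assms] g_nonzero[OF assms]])
  have "\<forall>j. - pderiv_at j N p = \<kappa> (p $ 1) j *\<^sub>R pderiv_at j X p"
    using nonzero[OF U_D[OF assms]]
    unfolding forall_3 vec_eq_iff forall_4 pderiv_at_X[OF assms] pderiv_at_N[OF assms]
    by (simp add: \<kappa>_def \<alpha>_def \<beta>_def \<alpha>1_def \<beta>1_def)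
  then show "- pderiv_at j N p = \<kappa> (p $ 1) j *\<^sub>R pderiv_at j X p" for j
    by blast
qed

lemma oriented: "oriented_hypersurface U X N"
proof -
  have "det (metric X p) \<noteq> 0" if "p \<in> U" for p
    using g_nonzero[OF that] by (simp add: metric_X[OF that] det_diagm)
  moreover have "\<forall>i. lorentz (N p) (pderiv_at i X p) = 0" if "p \<in> U" for p
  proof -
    note h = cosh_sq[of "p $ 2"] cosh_sq[of "p $ 3"]
    have ab: "\<alpha> (p $ 1) = f1 (p $ 1) * \<beta> (p $ 1)"
      by (simp add: \<alpha>_def \<beta>_def)
    show ?thesis
      unfolding forall_3 pderiv_at_X[OF that] lorentz_def N_nth[THEN fun_cong] sep_def vector_4_nth ab
      apply (intro conjI)
      using h apply algebra
      using h apply algebra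
      apply simp
      done
  qed
  moreover have "lorentz (N p) (N p) = 1" if "p \<in> U" for p
  proof -
    note h = cosh_sq[of "p $ 2"] cosh_sq[of "p $ 3"]
    \<comment> \<open>These relations remove the divisions by \<open>W\<close>, so that
      normalization becomes a polynomial consequence for \<open>algebra\<close>.\<close>
    have ab: "\<alpha> (p $ 1) = f1 (p $ 1) * \<beta> (p $ 1)" "\<beta> (p $ 1) * W (p $ 1) = -1"
      using W_pos[OF U_D[OF that]] by (simp_all add: \<alpha>_def \<beta>_def)
    show ?thesis
      unfolding lorentz_def N_nth[THEN fun_cong] sep_def
      using h ab W_sq[OF U_D[OF that]] by algebra
  qed
  ultimately show ?thesis
    unfolding oriented_hypersurface_def using open_U smooth_X smooth_N by auto
qed

(* The assumption eigen says that b(t) c(w) is an eigenfunction of the Laplacian of the hyperbolic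
   plane, whose metric is dt^2 + cosh^2 t dw^2. *)
lemma L_op_sep:
  assumes p: "p \<in> U"
    and a: "\<And>s. s \<in> I \<Longrightarrow> (a has_real_derivative a' s) (at s)"
      "(a' has_real_derivative a'') (at (p $ 1))"
    and b: "\<And>t. (b has_real_derivative b' t) (at t)" "\<And>t. (b' has_real_derivative b'' t) (at t)"
    and c: "\<And>w. (c has_real_derivative c' w) (at w)" "\<And>w. (c' has_real_derivative c'' w) (at w)"
    and eigen: "b'' (p $ 2) * c (p $ 3) + b (p $ 2) * c'' (p $ 3) / (cosh (p $ 2))\<^sup>2
        + sinh (p $ 2) / cosh (p $ 2) * b' (p $ 2) * c (p $ 3) = \<mu> * (b (p $ 2) * c (p $ 3))"
    and s: "s = p $ 1"
  shows "L_op 2 X N (sep a b c) p = b (p $ 2) * c (p $ 3) *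
     ((f1 s / (s * W s))\<^sup>2 * (- a'' / (W s)\<^sup>2 - a' s * f1 s * f2 s / W s ^ 4)
      + f2 s / W s ^ 3 * (f1 s / (s * W s)) * (\<mu> * a s / s\<^sup>2 - 2 * a' s / (s * (W s)\<^sup>2)))"
proof -
  let ?t = "p $ 2" and ?w = "p $ 3"
  have sI: "s \<in> I" using U_D[OF p] s by simp
  note s0 = nonzero[OF sI] and W0 = W_pos[OF sI]
  let ?H = "\<lambda>i. hessian_op X (sep a b c) p $ i $ i"
  note one = DERIV_const[of 1]
  have DW: "((\<lambda>s. - (W s)\<^sup>2) has_real_derivative 2 * f1 s * f2 s) (at s)"
    using W0 by (auto intro!: derivative_eq_intros DERIV_W[OF sI])
  have DS: "((\<lambda>s. s\<^sup>2) has_real_derivative 2 * s) (at s)"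
    by (auto intro!: derivative_eq_intros)
  have DC: "((\<lambda>t. (cosh t)\<^sup>2) has_real_derivative 2 * cosh t * sinh t) (at t)" for t :: real
    by (auto intro!: derivative_eq_intros)
  have pd: "pderiv_at 1 (sep a b c) q = a' (q $ 1) * b (q $ 2) * c (q $ 3)"
    "pderiv_at 2 (sep a b c) q = a (q $ 1) * b' (q $ 2) * c (q $ 3)"
    "pderiv_at 3 (sep a b c) q = a (q $ 1) * b (q $ 2) * c' (q $ 3)" if "q \<in> U" for q
    using pderiv_at_sep[OF a(1)[OF U_D[OF that]] b(1) c(1)] by simp_all
  have pg1: "pderiv_at 1 (\<lambda>q. g q 1) p = 2 * f1 s * f2 s"
      "pderiv_at 2 (\<lambda>q. g q 1) p = 0" "pderiv_at 3 (\<lambda>q. g q 1) p = 0"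
    using pderiv_at_sep[OF DW[unfolded s] one one] by (simp_all add: g_def s)
  have pg2: "pderiv_at 1 (\<lambda>q. g q 2) p = 2 * s"
      "pderiv_at 2 (\<lambda>q. g q 2) p = 0" "pderiv_at 3 (\<lambda>q. g q 2) p = 0"
    using pderiv_at_sep[OF DS[unfolded s] one one] by (simp_all add: g_def s)
  have pg3: "pderiv_at 1 (\<lambda>q. g q 3) p = 2 * s * (cosh ?t)\<^sup>2"
      "pderiv_at 2 (\<lambda>q. g q 3) p = s\<^sup>2 * (2 * cosh ?t * sinh ?t)" "pderiv_at 3 (\<lambda>q. g q 3) p = 0"
    using pderiv_at_sep[OF DS[unfolded s] DC one] by (simp_all add: g_def s)
  have g: "g p 1 = - (W s)\<^sup>2" "g p 2 = s\<^sup>2" "g p 3 = s\<^sup>2 * (cosh ?t)\<^sup>2"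
    by (simp_all add: g_def sep_def s)
  have h1: "pderiv_at 1 (\<lambda>q. pderiv_at 1 (sep a b c) q / g q 1) p =
      (- a'' / (W s)\<^sup>2 - 2 * a' s * f1 s * f2 s / W s ^ 4) * b ?t * c ?w"
  proof -
    have "pderiv_at 1 (\<lambda>q. pderiv_at 1 (sep a b c) q / g q 1) p =
        pderiv_at 1 (sep (\<lambda>s. - (a' s / (W s)\<^sup>2)) b c) p"
      by (rule pderiv_at_cong[OF open_U p]) (simp add: pd, simp add: g_def sep_def)
    moreover have D: "((\<lambda>s. - (a' s / (W s)\<^sup>2)) has_real_derivative
        - a'' / (W s)\<^sup>2 - 2 * a' s * f1 s * f2 s / W s ^ 4) (at s)"
      using W0 a(2)[folded s]
      by (auto intro!: derivative_eq_intros DERIV_W[OF sI])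
        (simp add: divide_simps; algebra)
    ultimately show ?thesis
      by (simp only: pderiv_at_sep(1)[OF D[unfolded s] b(1) c(1)] s)
  qed
  \<comment> \<open>\<open>pderiv_at_sep\<close> asks for a derivative of every factor, so the
    radial quotient in \<open>h2\<close> and \<open>h3\<close> is given one.\<close>
  have Das: "((\<lambda>s. a s / s\<^sup>2) has_real_derivative (a' s * s\<^sup>2 - a s * (2 * s)) / (s\<^sup>2 * s\<^sup>2)) (at s)"
    using s0 by (intro DERIV_divide a(1)[OF sI] DS) auto
  have h2: "pderiv_at 2 (\<lambda>q. pderiv_at 2 (sep a b c) q / g q 2) p = a s / s\<^sup>2 * b'' ?t * c ?w"
  proof -
    have "pderiv_at 2 (\<lambda>q. pderiv_at 2 (sep a b c) q / g q 2) p =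
        pderiv_at 2 (sep (\<lambda>s. a s / s\<^sup>2) b' c) p"
      by (rule pderiv_at_cong[OF open_U p]) (simp add: pd, simp add: g_def sep_def)
    then show ?thesis
      using pderiv_at_sep(2)[OF Das[unfolded s] b(2) c(1)] s by simp
  qed
  have h3: "pderiv_at 3 (\<lambda>q. pderiv_at 3 (sep a b c) q / g q 3) p =
      a s / s\<^sup>2 * (b ?t / (cosh ?t)\<^sup>2) * c'' ?w"
  proof -
    \<comment> \<open>The metric coefficient depends on both s and t; its factor
      \<open>(cosh t)\<^sup>2\<close> is absorbed into the middle factor to keep the quotient
      separated.\<close>
    have "pderiv_at 3 (\<lambda>q. pderiv_at 3 (sep a b c) q / g q 3) p =
        pderiv_at 3 (sep (\<lambda>s. a s / s\<^sup>2) (\<lambda>t. b t / (cosh t)\<^sup>2) c') p"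
      by (rule pderiv_at_cong[OF open_U p]) (simp add: pd, simp add: g_def sep_def)
    then show ?thesis
      using pderiv_at_sep(3)[OF Das[unfolded s] DERIV_divide[OF b(1) DC] c(2)] s by simp
  qed
  have H: "?H i = pderiv_at i (\<lambda>q. pderiv_at i (sep a b c) q / g q i) p
      + (\<Sum>k\<in>UNIV. pderiv_at k (\<lambda>q. g q i) p * (pderiv_at k (sep a b c) p / g p k)) / (2 * g p i)" for i
    by (rule hessian_op_diagonal_entry[OF open_U p]) (simp_all add: metric_X g_nonzero)
  \<comment> \<open>The Christoffel term cancels half of the first-order term in
    \<open>h1\<close>.\<close>
  have H1: "?H 1 = b ?t * c ?w * (- a'' / (W s)\<^sup>2 - a' s * f1 s * f2 s / W s ^ 4)"
    unfolding H h1 sum_3 pg1 g pd[OF p] s[symmetric] using W0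
    by (simp add: divide_simps; algebra)
  have H2: "?H 2 = a s / s\<^sup>2 * (b'' ?t * c ?w) - b ?t * c ?w * (a' s / (s * (W s)\<^sup>2))"
    unfolding H h2 sum_3 pg2 g pd[OF p] s[symmetric] using W0 s0
    by (simp add: divide_simps; algebra)
  have H3: "?H 3 = a s / s\<^sup>2 * (b ?t * c'' ?w / (cosh ?t)\<^sup>2 + sinh ?t / cosh ?t * b' ?t * c ?w)
      - b ?t * c ?w * (a' s / (s * (W s)\<^sup>2))"
    unfolding H h3 sum_3 pg3 g pd[OF p] s[symmetric] using W0 s0 cosh_real_pos[of ?t]
    by (simp add: divide_simps; algebra)
  \<comment> \<open>The two rotational directions have equal weight in the Newton transformation.
    Only the sum of their entries contains the hyperbolic Laplacian, to which \<open>eigen\<close>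
    applies.\<close>
  have "?H 2 + ?H 3 = a s / s\<^sup>2 * (b'' ?t * c ?w + b ?t * c'' ?w / (cosh ?t)\<^sup>2
      + sinh ?t / cosh ?t * b' ?t * c ?w) - 2 * (b ?t * c ?w * (a' s / (s * (W s)\<^sup>2)))"
    unfolding H2 H3 by (simp add: algebra_simps)
  then have H23: "?H 2 + ?H 3 = b ?t * c ?w * (\<mu> * a s / s\<^sup>2 - 2 * a' s / (s * (W s)\<^sup>2))"
    unfolding eigen by (simp add: algebra_simps)
  define x y where "x = f2 s / W s ^ 3" and "y = f1 s / (s * W s)"
  have \<kappa>: "\<kappa> s 1 = x" "\<kappa> s 2 = y" "\<kappa> s 3 = y"
    by (simp_all add: \<kappa>_def x_def y_def)
  \<comment> \<open>With principal curvatures \<open>x\<close>, \<open>y\<close>, \<open>y\<close>,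
    the second Newton transformation has diagonal \<open>y\<^sup>2\<close>, \<open>x * y\<close>,
    \<open>x * y\<close>.\<close>
  have "L_op 2 X N (sep a b c) p = y\<^sup>2 * ?H 1 + x * y * (?H 2 + ?H 3)"
    unfolding L_op_def newton_2_diagm[OF shape_op_rot[OF p]] trace_diagm_mult sum_3 s[symmetric] \<kappa>
    by (simp add: algebra_simps power2_eq_square)
  then show ?thesis
    unfolding H1 H23 x_def y_def by (simp add: algebra_simps)
qed

text \<open>The numerator is the bracket that multiplies \<open>C_4 W - 1\<close> in the
  differential equation. The denominator has no zero on \<open>I\<close>.\<close>

definition m :: "real \<Rightarrow> real" where
  "m s = (s * ((f1 s)\<^sup>2 - 1) * f1 s * f3 s
      + 2 * f2 s * (f1 s * ((f1 s)\<^sup>2 - 1)\<^sup>2 - s * (2 * (f1 s)\<^sup>2 + 1) * f2 s)) / (s ^ 3 * W s ^ 8)"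

lemma smooth_m: "smooth_on I m"
proof -
  have "smooth_on I (\<lambda>s. s)"
    by (rule smooth_on_linear[OF open_I bounded_linear_ident])
  moreover have "s ^ 3 * W s ^ 8 \<noteq> 0" if "s \<in> I" for s
    using W_pos[OF that] nonzero[OF that] by simp
  ultimately show ?thesis
    unfolding m_def[abs_def]
    by (intro smooth_on_divide smooth_on_mult smooth_on_add smooth_on_diff smooth_on_power
        smooth_on_const smooth_f1 smooth_f2 smooth_f3 smooth_W open_I)
qed

(* The left-hand sides of the next two identities are the radial factors that L_op_sep yields for
   the pairs (\<alpha>, \<mu> = 2) and (\<beta>, \<mu> = 0), kept unsimplified so that they rewrite. *)
lemma L_horizontal:
  assumes "s \<in> I"
  shows "(f1 s / (s * W s))\<^sup>2 * (- (- (f3 s / W s ^ 3 + 3 * f1 s * (f2 s)\<^sup>2 / W s ^ 5)) / (W s)\<^sup>2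
        - \<alpha>1 s * f1 s * f2 s / W s ^ 4)
      + f2 s / W s ^ 3 * (f1 s / (s * W s)) * (2 * \<alpha> s / s\<^sup>2 - 2 * \<alpha>1 s / (s * (W s)\<^sup>2)) = m s * \<alpha> s"
proof -
  have u2: "(f1 s)\<^sup>2 = 1 - (W s)\<^sup>2"
    using W_sq[OF assms] by simp
  show ?thesis
    unfolding m_def \<alpha>_def \<alpha>1_def using W_pos[OF assms] nonzero[OF assms] u2
    by (simp add: divide_simps) algebra
qed

lemma L_vertical:
  assumes s: "s \<in> I"
    and ode: "(C * W s - 1) *
        (s * ((f1 s)\<^sup>2 - 1) * f1 s * f3 s
          + 2 * f2 s * (f1 s * ((f1 s)\<^sup>2 - 1)\<^sup>2 - s * (2 * (f1 s)\<^sup>2 + 1) * f2 s))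
      + s * (f1 s)\<^sup>2 * (((f1 s)\<^sup>2 - 1) * f1 s * f3 s - 3 * ((f1 s)\<^sup>2 + 1) * (f2 s)\<^sup>2) = 0"
  shows "(f1 s / (s * W s))\<^sup>2
        * (- (- (((f2 s)\<^sup>2 + f1 s * f3 s) / W s ^ 3 + 3 * (f1 s)\<^sup>2 * (f2 s)\<^sup>2 / W s ^ 5)) / (W s)\<^sup>2
        - \<beta>1 s * f1 s * f2 s / W s ^ 4)
      + f2 s / W s ^ 3 * (f1 s / (s * W s)) * (0 * \<beta> s / s\<^sup>2 - 2 * \<beta>1 s / (s * (W s)\<^sup>2)) = m s * (\<beta> s + C)"
    (is "?L = ?R")
proof -
  \<comment> \<open>In this notation the differential equation reads
    \<open>(C * W s - 1) * B + s * D = 0\<close>, and \<open>m s\<close> is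
    \<open>B / (s ^ 3 * W s ^ 8)\<close>.\<close>
  define B where "B = s * ((f1 s)\<^sup>2 - 1) * f1 s * f3 s
          + 2 * f2 s * (f1 s * ((f1 s)\<^sup>2 - 1)\<^sup>2 - s * (2 * (f1 s)\<^sup>2 + 1) * f2 s)"
  define D where "D = (f1 s)\<^sup>2 * (((f1 s)\<^sup>2 - 1) * f1 s * f3 s - 3 * ((f1 s)\<^sup>2 + 1) * (f2 s)\<^sup>2)"
  have u2: "(f1 s)\<^sup>2 = 1 - (W s)\<^sup>2"
    using W_sq[OF s] by simp
  note nz = W_pos[OF s] nonzero[OF s]
  have "?L = - D / (s\<^sup>2 * W s ^ 9)"
    unfolding D_def \<beta>1_def using nz u2
    by (simp add: divide_simps) algebra
  \<comment> \<open>This is where the differential equation enters; the equality before it is the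
    direct computation for the last component.\<close>
  also have "\<dots> = (C * W s - 1) * B / (s ^ 3 * W s ^ 9)"
  proof -
    have "(C * W s - 1) * B = - (s * D)"
      using ode unfolding B_def D_def by (simp add: algebra_simps)
    then show ?thesis
      using nz by (simp add: power2_eq_square power3_eq_cube)
  qed
  \<comment> \<open>The constant is absorbed through
    \<open>\<beta> s + C = (C * W s - 1) / W s\<close>.\<close>
  also have "\<dots> = ?R"
    unfolding m_def B_def[symmetric] \<beta>_def using nz
    by (simp add: divide_simps) algebra
  finally show ?thesis .
qed

lemma L_vec_N:
  assumes p: "p \<in> U" and s: "s = p $ 1"
    and ode: "(C * W s - 1) *
        (s * ((f1 s)\<^sup>2 - 1) * f1 s * f3 s
          + 2 * f2 s * (f1 s * ((f1 s)\<^sup>2 - 1)\<^sup>2 - s * (2 * (f1 s)\<^sup>2 + 1) * f2 s))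
      + s * (f1 s)\<^sup>2 * (((f1 s)\<^sup>2 - 1) * f1 s * f3 s - 3 * ((f1 s)\<^sup>2 + 1) * (f2 s)\<^sup>2) = 0"
  shows "L_vec 2 X N N p = m s *\<^sub>R (N p + vector [0, 0, 0, C])"
proof -
  have sI: "s \<in> I" using U_D[OF p] s by simp
  note \<alpha> = DERIV_\<alpha> DERIV_\<alpha>1[OF U_D[OF p]]
  note \<beta> = DERIV_\<beta> DERIV_\<beta>1[OF U_D[OF p]]
  note hyp = DERIV_hyperbolic
  have zero: "((\<lambda>_. 0) has_real_derivative 0) (at x)" for x :: real
    by simp
  have ch: "cosh (p $ 2) \<noteq> 0" using cosh_real_pos[of "p $ 2"] by simp
  note sq = cosh_sq[of "p $ 2"]
  \<comment> \<open>The first three components share the radial factor \<open>\<alpha>\<close> and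
    the eigenvalue 2, so they differ only in the eigenfunction check.\<close>
  have horizontal: "L_op 2 X N (sep \<alpha> b c) p = m s * sep \<alpha> b c p"
    if "\<And>t. (b has_real_derivative b' t) (at t)" "\<And>t. (b' has_real_derivative b'' t) (at t)"
      "\<And>w. (c has_real_derivative c' w) (at w)" "\<And>w. (c' has_real_derivative c'' w) (at w)"
      "b'' (p $ 2) * c (p $ 3) + b (p $ 2) * c'' (p $ 3) / (cosh (p $ 2))\<^sup>2
        + sinh (p $ 2) / cosh (p $ 2) * b' (p $ 2) * c (p $ 3) = 2 * (b (p $ 2) * c (p $ 3))"
    for b b' b'' c c' c''
    by (simp only: L_op_sep[OF p \<alpha> that s] s[symmetric] L_horizontal[OF sI])
      (simp add: sep_def s)
  have "L_op 2 X N (\<lambda>q. N q $ 1) p = m s * N p $ 1"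
    unfolding N_nth N_nth[THEN fun_cong]
    by (rule horizontal[OF hyp(1,2) hyp(1,2)]) (use ch sq in \<open>simp add: divide_simps; algebra\<close>)
  moreover have "L_op 2 X N (\<lambda>q. N q $ 2) p = m s * N p $ 2"
    unfolding N_nth N_nth[THEN fun_cong]
    by (rule horizontal[OF hyp(2,1) hyp(3) zero]) (use ch in simp)
  moreover have "L_op 2 X N (\<lambda>q. N q $ 3) p = m s * N p $ 3"
    unfolding N_nth N_nth[THEN fun_cong]
    by (rule horizontal[OF hyp(1,2) hyp(2,1)]) (use ch sq in \<open>simp add: divide_simps; algebra\<close>)
  moreover have "L_op 2 X N (\<lambda>q. N q $ 4) p = m s * (N p $ 4 + C)"
  proof -
    \<comment> \<open>The factors \<open>1 * 1\<close> stand for the constant angular functions.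
      With \<open>L_vertical\<close> read backwards, the goal has the shape of
      \<open>L_op_sep\<close> with eigenvalue 0.\<close>
    have "L_op 2 X N (sep \<beta> (\<lambda>_. 1) (\<lambda>_. 1)) p = 1 * 1 * (m (p $ 1) * (\<beta> (p $ 1) + C))"
      unfolding L_vertical[OF sI ode, symmetric, unfolded s]
      by (rule L_op_sep[OF p \<beta> hyp(3) zero hyp(3) zero _ refl]) simp_all
    then show ?thesis
      unfolding N_nth N_nth[THEN fun_cong] by (simp add: sep_def s)
  qed
  ultimately show ?thesis
    by (simp add: vec_eq_iff forall_4 L_vec_def)
qed

end

theorem theorem12:
  fixes I :: "real set" and f :: "real \<Rightarrow> real" and C4 :: real
  assumes "open I" and "is_interval I" and "0 \<notin> I"
    and "smooth_on I f"
    and "\<forall>s\<in>I. (deriv f s)^2 < 1"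
    and "\<forall>s\<in>I. (deriv ^^ 2) f s \<noteq> 0"
    and "C4 \<noteq> 0"
    and "\<exists>p\<in>rot_domain I. L_vec 2 (rot_hypersurface f) (rot_gauss f) (rot_gauss f) p \<noteq> 0"
    and "\<forall>s\<in>I. let f' = deriv f s; f'' = (deriv ^^ 2) f s; f''' = (deriv ^^ 3) f s in
           (C4 * sqrt (1 - f'^2) - 1) *
             (s * (f'^2 - 1) * f' * f''' + 2 * f'' * (f' * (f'^2 - 1)^2 - s * (2 * f'^2 + 1) * f''))
           + s * f'^2 * ((f'^2 - 1) * f' * f''' - 3 * (f'^2 + 1) * f''^2) = 0"
  shows "second_kind_pointwise_1_type_gauss 2 (rot_domain I) (rot_hypersurface f) (rot_gauss f) \<and>
    (\<exists>m. smooth_on (rot_domain I) m \<and> (\<exists>p\<in>rot_domain I. m p \<noteq> 0) \<and>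
         (\<forall>p\<in>rot_domain I. L_vec 2 (rot_hypersurface f) (rot_gauss f) (rot_gauss f) p
            = m p *\<^sub>R (rot_gauss f p + vector [0, 0, 0, C4])))"
proof -
  interpret rotational I f
    using assms(1,3,4,5) by unfold_locales auto
  let ?C = "vector [0, 0, 0, C4] :: real^4"
  have pow: "(deriv ^^ 2) f = deriv (deriv f)" "(deriv ^^ 3) f = deriv (deriv (deriv f))"
    by (simp_all add: numeral_2_eq_2 numeral_3_eq_3)
  have L: "L_vec 2 X N N p = m (p $ 1) *\<^sub>R (N p + ?C)" if "p \<in> U" for p
    using assms(9) U_D[OF that] by (intro L_vec_N[OF that refl]) (auto simp: Let_def pow W_def)
  have smooth: "smooth_on U (\<lambda>p. m (p $ 1))"
    by (rule smooth_on_coord[OF smooth_m])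
  \<comment> \<open>At a point where \<open>L_vec\<close> is nonzero its scalar factor
    \<open>m\<close> is nonzero too.\<close>
  obtain p where p: "p \<in> U" "m (p $ 1) \<noteq> 0"
    using assms(8) L by fastforce
  have "?C $ 4 \<noteq> 0"
    using assms(7) by simp
  then have "?C \<noteq> 0"
    by (metis zero_index)
  then have "second_kind_pointwise_1_type_gauss 2 U X N"
    unfolding second_kind_pointwise_1_type_gauss_def using oriented smooth p L by blast
  then show ?thesis
    using smooth p L by blast
qed

end
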